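(* Let $\mathcal M_\star=(X_\star,U_\star,T_\star,x_\star,\rho_\star)$ be the product MDP of a finite MDP $\widehat\Sigma$ and a co-safety automaton $\mathcal A_\phi$ (unrolled for a finite time horizon). For $\kappa>0$ let $\mathcal M_\kappa=(X_\star,U_\star,T_\star,x_\star,\rho_\kappa)$ be the same MDP with the shaped reward function $\rho_\kappa$. Then there exists $\kappa_\star>0$ such that for all $0<\kappa<\kappa_\star$ the set of policies that are optimal for the expected total reward in $\mathcal M_\star$ is the same as the set of policies that are optimal for the expected total reward in $\mathcal M_\kappa$.
   Context: **Finite MDP.** $\widehat\Sigma=(\hat X,\hat U,\hat T)$ has finite state set $\hat X$, finite action set $\hat U$, transition probabilities $\hat T(x,\nu,x')$ (the probability of moving from $x$ to $x'$ under action $\nu$), and initial state $\hat x_0\in\hat X$. States carry labels given by $\mathsf L:\hat X\to\Sigma_{\mathsf a}$, where $\Sigma_{\mathsf a}$ is a finite alphabet. **Co-safety automaton.** $\mathcal A_\phi=(Q,\Sigma_{\mathsf a},\mathsf t,q_0,q_F)$ is a deterministic finite automaton with transition function $\mathsf t:Q\times\Sigma_{\mathsf a}\to Q$, initial state $q_0$, and a unique accepting state $q_F$ all of whose outgoing transitions are self-loops. It represents satisfaction of a specification $\phi$ within a finite time horizon $[0,T]$, $T\in\mathbb N$, and is obtained by unrolling an automaton for $\phi$ over this horizon: after reading $T+1$ letters from $q_0$, the automaton is either in $q_F$ or in a state from which $q_F$ is not reachable. **Product MDP.** $X_\star=\hat X\times Q$, $U_\star=\hat U$, $x_\star=(\hat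 x_0,q_0)$. The transition function is $T_\star((x,q),\nu,(x',q'))=\hat T(x,\nu,x')$ if $q'=\mathsf t(q,\mathsf L(x))$ and $0$ otherwise. The reward is $\rho_\star((x,q),\nu,(x',q'))=1$ if $q\ne q_F$ and $q'=q_F$, and $0$ otherwise. **Shaped reward.** Let $d(q)$ be the minimum distance (number of transitions in the automaton graph) from $q\in Q$ to $q_F$. Let $d_{\max}=1+\max\{d(q): q\in Q,\ d(q)<\infty\}$. If there is no path from $q$ to $q_F$, set $d(q)=d_{\max}$. It is assumed that $q_0\neq q_F$ and $d_{\max}>1$, so that the following is well defined. The potential function is $$P(d)=\begin{cases}\kappa\,\dfrac{d-d(q_0)}{1-d_{\max}}, & d>0,\\[2mm] 1,& d=0,\end{cases}$$ where $\kappa$ is a constant hyper-parameter. The shaped reward is $\rho_\kappa((x,q),\nu,(x',q'))=P(d(q'))-P(d(q))$. **Optimality.** A policy is a rule choosing (possibly randomly, possibly depending on the history) an action at each step. Its expected total reward is the expectation, over runs started in $x_\star$, of the sum of the rewards along the run. A policy is optimal if it maximizes this quantity over all policies. *)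

theory Defs
  imports "HOL-Probability.Probability" "HOL-Library.Extended_Nat"
begin

section \<open>Finite Markov decision processes\<close>

text \<open>
  State, action and letter sets are types of class \<open>finite\<close>. The transition function is
  real-valued; \<open>is_mdp\<close> says that each \<open>tprob M s a\<close> is a probability distribution. MDPs with
  reward extend the record by a reward on transitions.
\<close>

record ('s, 'a) mdp =
  tprob :: "'s \<Rightarrow> 'a \<Rightarrow> 's \<Rightarrow> real"
  init_st :: 's

record ('s, 'a) rmdp = "('s, 'a) mdp" +
  rew :: "'s \<Rightarrow> 'a \<Rightarrow> 's \<Rightarrow> real"

definition is_mdp :: "('s::finite, 'a::finite, 'z) mdp_scheme \<Rightarrow> bool" where
  "is_mdp M \<longleftrightarrow> (\<forall>s a s'. 0 \<le> tprob M s a s') \<and> (\<forall>s a. (\<Sum>s'\<in>UNIV. tprob M s a s') = 1)"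

lemma pmf_embed_tprob:
  assumes "is_mdp M"
  shows "pmf (embed_pmf (tprob M s a)) s' = tprob M s a s'"
proof (rule pmf_embed_pmf)
  show "0 \<le> tprob M s a x" for x
    using assms by (simp add: is_mdp_def)
  have "(\<integral>\<^sup>+x. ennreal (tprob M s a x) \<partial>count_space UNIV) = ennreal (\<Sum>x\<in>UNIV. tprob M s a x)"
    using assms by (simp add: nn_integral_count_space_finite sum_ennreal is_mdp_def)
  then show "(\<integral>\<^sup>+x. ennreal (tprob M s a x) \<partial>count_space UNIV) = 1"
    using assms by (simp add: is_mdp_def)
qed


section \<open>Policies, runs and expected total reward\<close>

text \<open>
  A policy maps the past state-action pairs (oldest first) and the current state to a
  distribution over actions: it may be randomised and history-dependent.
\<close>

type_synonym ('s, 'a) policy = "('s \<times> 'a) list \<Rightarrow> 's \<Rightarrow> 'a pmf"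

text \<open>
  A run is an infinite sequence of pairs (state at time \<open>n\<close>, action taken at time \<open>n\<close>).
  \<open>run_step M \<pi> n \<omega>\<close> is the conditional distribution of the \<open>n\<close>-th pair given the first \<open>n\<close>
  pairs of \<open>\<omega>\<close>; the law of the run is the measure on infinite sequences that the
  Ionescu-Tulcea theorem provides for these kernels.
\<close>

definition run_step ::
  "('s, 'a, 'z) mdp_scheme \<Rightarrow> ('s, 'a) policy \<Rightarrow> nat \<Rightarrow> (nat \<Rightarrow> 's \<times> 'a) \<Rightarrow> ('s \<times> 'a) pmf" where
  "run_step M \<pi> n \<omega> =
    bind_pmf
      (case n of 0 \<Rightarrow> return_pmf (init_st M)
               | Suc m \<Rightarrow> embed_pmf (tprob M (fst (\<omega> m)) (snd (\<omega> m))))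
      (\<lambda>s. map_pmf (Pair s) (\<pi> (map \<omega> [0..<n]) s))"

definition run_measure ::
  "('s, 'a, 'z) mdp_scheme \<Rightarrow> ('s, 'a) policy \<Rightarrow> (nat \<Rightarrow> 's \<times> 'a) measure" where
  "run_measure M \<pi> =
    projective_family.lim UNIV
      (Ionescu_Tulcea.CI (\<lambda>n \<omega>. measure_pmf (run_step M \<pi> n \<omega>)) (\<lambda>_. count_space UNIV))
      (\<lambda>_. count_space UNIV)"

lemma Ionescu_Tulcea_run_step:
  fixes M :: "('s::finite, 'a::finite, 'z) mdp_scheme"
  shows "Ionescu_Tulcea (\<lambda>n \<omega>. measure_pmf (run_step M \<pi> n \<omega>)) (\<lambda>_. count_space UNIV)"
proof
  fix n :: nat
  have "(PiM {0..<n} (\<lambda>_. count_space (UNIV :: ('s \<times> 'a) set)))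
      = count_space (PiE {0..<n} (\<lambda>_. UNIV))"
    by (rule count_space_PiM_finite) (auto simp: countable_finite)
  then show "(\<lambda>\<omega>. measure_pmf (run_step M \<pi> n \<omega>))
      \<in> PiM {0..<n} (\<lambda>_. count_space UNIV) \<rightarrow>\<^sub>M subprob_algebra (count_space UNIV)"
    by (simp add: measure_pmf_in_subprob_algebra)
qed

text \<open>
  The series need not converge on every run; for the product MDPs below with an unrolled
  automaton, almost surely all but finitely many of its terms vanish.
\<close>

definition total_reward :: "('s, 'a) rmdp \<Rightarrow> (nat \<Rightarrow> 's \<times> 'a) \<Rightarrow> real" where
  "total_reward M \<omega> = (\<Sum>n. rew M (fst (\<omega> n)) (snd (\<omega> n)) (fst (\<omega> (Suc n))))"

definition expected_total_reward :: "('s, 'a) rmdp \<Rightarrow> ('s, 'a) policy \<Rightarrow> real" where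
  "expected_total_reward M \<pi> = (\<integral>\<omega>. total_reward M \<omega> \<partial>run_measure M \<pi>)"

definition optimal_policy :: "('s, 'a) rmdp \<Rightarrow> ('s, 'a) policy \<Rightarrow> bool" where
  "optimal_policy M \<pi> \<longleftrightarrow> (\<forall>\<pi>'. expected_total_reward M \<pi>' \<le> expected_total_reward M \<pi>)"


section \<open>Co-safety automata\<close>

record ('q, 'l) dfa =
  delta :: "'q \<Rightarrow> 'l \<Rightarrow> 'q"
  start :: 'q
  final :: 'q

definition edges :: "('q, 'l) dfa \<Rightarrow> ('q \<times> 'q) set" where
  "edges A = {(q, delta A q l) | q l. True}"

definition cosafety :: "('q, 'l) dfa \<Rightarrow> bool" where
  "cosafety A \<longleftrightarrow> (\<forall>l. delta A (final A) l = final A)"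

text \<open>
  The property that unrolling over the horizon \<open>[0, T]\<close> provides: after reading
  \<open>T + 1\<close> letters the automaton has either accepted or can no longer do so.
\<close>

definition unrolled :: "nat \<Rightarrow> ('q, 'l) dfa \<Rightarrow> bool" where
  "unrolled T A \<longleftrightarrow>
    (\<forall>w. length w = T + 1 \<longrightarrow>
      foldl (delta A) (start A) w = final A \<or>
      (foldl (delta A) (start A) w, final A) \<notin> (edges A)\<^sup>*)"

text \<open>The infimum is \<open>\<infinity>\<close> if the accepting state is not reachable from \<open>q\<close>.\<close>

definition path_dist :: "('q, 'l) dfa \<Rightarrow> 'q \<Rightarrow> enat" where
  "path_dist A q = (INF n \<in> {n. (q, final A) \<in> edges A ^^ n}. enat n)"

definition d_max :: "('q::finite, 'l) dfa \<Rightarrow> nat" where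
  "d_max A = 1 + Max {the_enat (path_dist A q) | q. path_dist A q < \<infinity>}"

definition d_final :: "('q::finite, 'l) dfa \<Rightarrow> 'q \<Rightarrow> nat" where
  "d_final A q = (if path_dist A q < \<infinity> then the_enat (path_dist A q) else d_max A)"


section \<open>Product MDP and shaped reward\<close>

definition product_tprob ::
  "('x, 'u) mdp \<Rightarrow> ('x \<Rightarrow> 'l) \<Rightarrow> ('q, 'l) dfa \<Rightarrow> 'x \<times> 'q \<Rightarrow> 'u \<Rightarrow> 'x \<times> 'q \<Rightarrow> real" where
  "product_tprob S L A = (\<lambda>(x, q) u (x', q').
    if q' = delta A q (L x) then tprob S x u x' else 0)"

definition star_reward :: "('q, 'l) dfa \<Rightarrow> 'x \<times> 'q \<Rightarrow> 'u \<Rightarrow> 'x \<times> 'q \<Rightarrow> real" where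
  "star_reward A = (\<lambda>(x, q) u (x', q'). if q \<noteq> final A \<and> q' = final A then 1 else 0)"

definition potential :: "real \<Rightarrow> ('q::finite, 'l) dfa \<Rightarrow> nat \<Rightarrow> real" where
  "potential \<kappa> A d =
    (if d > 0 then \<kappa> * ((real d - real (d_final A (start A))) / (1 - real (d_max A))) else 1)"

definition shaped_reward ::
  "real \<Rightarrow> ('q::finite, 'l) dfa \<Rightarrow> 'x \<times> 'q \<Rightarrow> 'u \<Rightarrow> 'x \<times> 'q \<Rightarrow> real" where
  "shaped_reward \<kappa> A = (\<lambda>(x, q) u (x', q').
    potential \<kappa> A (d_final A q') - potential \<kappa> A (d_final A q))"

definition product_mdp ::
  "('x, 'u) mdp \<Rightarrow> ('x \<Rightarrow> 'l) \<Rightarrow> ('q, 'l) dfa \<Rightarrow> ('x \<times> 'q, 'u) rmdp" where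
  "product_mdp S L A =
    \<lparr>tprob = product_tprob S L A, init_st = (init_st S, start A), rew = star_reward A\<rparr>"

definition shaped_mdp ::
  "real \<Rightarrow> ('x, 'u) mdp \<Rightarrow> ('x \<Rightarrow> 'l) \<Rightarrow> ('q::finite, 'l) dfa \<Rightarrow> ('x \<times> 'q, 'u) rmdp" where
  "shaped_mdp \<kappa> S L A = (product_mdp S L A)\<lparr>rew := shaped_reward \<kappa> A\<rparr>"

lemma is_mdp_product_mdp:
  fixes S :: "('x::finite, 'u::finite) mdp" and A :: "('q::finite, 'l) dfa"
  assumes "is_mdp S"
  shows "is_mdp (product_mdp S L A)"
proof -
  have "(\<Sum>s'\<in>UNIV. product_tprob S L A (x, q) u s') = 1" for x q u
  proof -
    have "(\<Sum>s'\<in>UNIV. product_tprob S L A (x, q) u s')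
        = (\<Sum>x'\<in>UNIV. \<Sum>q'\<in>UNIV. product_tprob S L A (x, q) u (x', q'))"
      by (simp add: sum.cartesian_product)
    also have "\<dots> = (\<Sum>x'\<in>UNIV. tprob S x u x')"
      by (simp add: product_tprob_def)
    finally show ?thesis
      using assms by (simp add: is_mdp_def)
  qed
  then show ?thesis
    using assms by (auto simp: is_mdp_def product_mdp_def product_tprob_def)
qed

end

theory Submission
  imports Defs
begin

text \<open>
  Both rewards are potential differences, so they telescope along a run: the total rewards are
  \<open>1\<close> for both if the automaton accepts, and otherwise \<open>0\<close> and
  \<open>c = P(d\<^sub>m\<^sub>a\<^sub>x) - P(d(q\<^sub>0)) \<le> 0\<close>, respectively, because after \<open>T + 1\<close> steps a run that has not
  accepted stays in states from which acceptance is unreachable. Hence the shaped value of a policy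
  is \<open>c + (1 - c) v\<close> with \<open>v\<close> its original value, a strictly increasing function of \<open>v\<close>; every
  \<open>\<kappa> > 0\<close> works.
\<close>

section \<open>Almost sure properties of runs\<close>

context Ionescu_Tulcea
begin

text \<open>The whole space is the cylinder over the empty index set, so its mass is that of the
  probability measure \<open>CI {}\<close>.\<close>

lemma prob_space_lim: "prob_space PF.lim"
proof
  interpret CI: prob_space "CI {}"
    by (rule PF.prob_space_P) auto
  have "PF.emb UNIV {} (space (PiM {} M)) = space PF.lim"
    by (auto simp: prod_emb_def space_PiM restrict_def)
  moreover have "emeasure (CI {}) (space (PiM {} M)) = 1"
    using CI.emeasure_space_1 by (simp add: PF.space_P)
  ultimately show "emeasure PF.lim (space PF.lim) = 1"
    using lim[of "{}" "space (PiM {} M)"] by simp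
qed

lemma AE_lim_kernel:
  assumes Q[measurable]: "Measurable.pred (PiM {0..<Suc n} M) Q"
    and AE_P: "\<And>x. x \<in> space (PiM {0..<n} M) \<Longrightarrow> AE y in P n x. Q (x(n := y))"
  shows "AE \<omega> in PF.lim. Q (restrict \<omega> {0..<Suc n})"
proof -
  \<comment> \<open>\<open>CI J\<close> composes the kernels up to the bound \<open>up_to J\<close>;
    here the last one is exactly the kernel at time \<open>n\<close>.\<close>
  have up: "up_to {0..<Suc n} = Suc n"
    using up_to_less[of "{0..<Suc n}" n] by (intro antisym) (auto simp: up_to_iff)
  have und: "(\<lambda>x. undefined) \<in> space (PiM {0..<0} M)"
    by (simp add: space_PiM)
  have C_step: "AE x in C 0 (Suc n) (\<lambda>x. undefined). Q x"
  proof -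
    have "AE y in eP n x. Q y" if x: "x \<in> space (PiM {0..<n} M)" for x
      unfolding eP_def
    proof (subst AE_distr_iff)
      have "fun_upd x n \<in> measurable (M n) (PiM {0..<Suc n} M)"
        using x by (intro measurable_fun_upd[where J="{0..<n}"]) auto
      then show "fun_upd x n \<in> measurable (P n x) (PiM {0..<Suc n} M)"
        by (simp add: measurable_cong_sets[OF sets_P[OF x]])
    qed (use AE_P[OF x] in auto)
    moreover have "eP n \<in> measurable (C 0 n (\<lambda>x. undefined)) (subprob_algebra (PiM {0..<Suc n} M))"
      using measurable_eP by (simp add: measurable_cong_sets[OF sets_C[OF und]])
    ultimately have "AE x in C 0 n (\<lambda>x. undefined) \<bind> eP n. Q x"
      using space_C[OF und, of n] by (subst AE_bind[OF _ Q]) (auto intro: AE_I2)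
    then show ?thesis
      unfolding C.simps add_0 .
  qed
  have "AE x in CI {0..<Suc n}. Q x"
    unfolding CI_def up
  proof (subst AE_distr_iff)
    show "(\<lambda>f. restrict f {0..<Suc n}) \<in> measurable (C 0 (Suc n) (\<lambda>x. undefined)) (PiM {0..<Suc n} M)"
      by (subst measurable_cong_sets[OF sets_C[OF und] refl]) (auto intro!: measurable_restrict)
    \<comment> \<open>Points of this space are already \<open>undefined\<close> outside
      \<open>{0..<Suc n}\<close>, so restricting them changes nothing.\<close>
    show "AE x in C 0 (Suc n) (\<lambda>x. undefined). Q (restrict x {0..<Suc n})"
      using C_step
    proof (rule AE_mp, intro AE_I2 impI)
      fix x assume "x \<in> space (C 0 (Suc n) (\<lambda>x. undefined))" "Q x"
      then show "Q (restrict x {0..<Suc n})"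
        using space_C[OF und, of "Suc n"] by (simp add: space_PiM del: C.simps)
    qed
  qed measurable
  then have "AE x in distr PF.lim (PiM {0..<Suc n} M) (\<lambda>x. restrict x {0..<Suc n}). Q x"
    by (subst distr_lim) auto
  moreover have "(\<lambda>x. restrict x {0..<Suc n}) \<in> measurable PF.lim (PiM {0..<Suc n} M)"
    by (subst measurable_cong_sets[OF PF.sets_lim refl]) (auto intro!: measurable_restrict)
  ultimately show ?thesis
    by (subst (asm) AE_distr_iff) auto
qed

end

lemma prob_space_run_measure:
  fixes M :: "('s::finite, 'a::finite, 'z) mdp_scheme"
  shows "prob_space (run_measure M \<pi>)"
  unfolding run_measure_def by (rule Ionescu_Tulcea.prob_space_lim[OF Ionescu_Tulcea_run_step])

lemma sets_run_measure:
  fixes M :: "('s::finite, 'a::finite, 'z) mdp_scheme"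
  shows "sets (run_measure M \<pi>) = sets (PiM UNIV (\<lambda>_. count_space UNIV))"
proof -
  interpret Ionescu_Tulcea "\<lambda>n \<omega>. measure_pmf (run_step M \<pi> n \<omega>)" "\<lambda>_. count_space UNIV"
    by (rule Ionescu_Tulcea_run_step)
  show ?thesis
    unfolding run_measure_def by (rule PF.sets_lim)
qed

text \<open>The kernel at time \<open>n\<close> reads only the past. This allows passing between a
  run, its restriction to a prefix, and its update at \<open>n\<close>.\<close>

lemma run_step_cong:
  assumes "\<And>i. i < n \<Longrightarrow> \<omega> i = \<omega>' i"
  shows "run_step M \<pi> n \<omega> = run_step M \<pi> n \<omega>'"
proof -
  have *: "map \<omega> [0..<n] = map \<omega>' [0..<n]"
    using assms by simp
  show ?thesis
    using assms unfolding run_step_def * by (cases n) (simp_all del: upt_Suc)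
qed

lemma AE_run_step:
  fixes M :: "('s::finite, 'a::finite, 'z) mdp_scheme"
  shows "AE \<omega> in run_measure M \<pi>. \<omega> n \<in> set_pmf (run_step M \<pi> n \<omega>)"
proof -
  interpret Ionescu_Tulcea "\<lambda>n \<omega>. measure_pmf (run_step M \<pi> n \<omega>)" "\<lambda>_. count_space UNIV"
    by (rule Ionescu_Tulcea_run_step)
  define Q where "Q \<omega> \<longleftrightarrow> \<omega> n \<in> set_pmf (run_step M \<pi> n \<omega>)" for \<omega>
  \<comment> \<open>A finite product of finite discrete spaces is discrete, so every predicate on
    prefixes is measurable.\<close>
  have "(PiM {0..<Suc n} (\<lambda>_. count_space (UNIV :: ('s \<times> 'a) set)))
      = count_space (PiE {0..<Suc n} (\<lambda>_. UNIV))"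
    by (rule count_space_PiM_finite) (auto simp: countable_finite)
  then have "Measurable.pred (PiM {0..<Suc n} (\<lambda>_. count_space (UNIV :: ('s \<times> 'a) set))) Q"
    by simp
  moreover have "AE y in measure_pmf (run_step M \<pi> n x). Q (x(n := y))" for x
  proof -
    have "run_step M \<pi> n (x(n := y)) = run_step M \<pi> n x" for y
      by (rule run_step_cong) simp
    then show ?thesis
      by (simp add: Q_def AE_measure_pmf)
  qed
  ultimately have "AE \<omega> in PF.lim. Q (restrict \<omega> {0..<Suc n})"
    by (rule AE_lim_kernel)
  moreover have "Q (restrict \<omega> {0..<Suc n}) \<longleftrightarrow> Q \<omega>" for \<omega>
  proof -
    have "run_step M \<pi> n (restrict \<omega> {0..<Suc n}) = run_step M \<pi> n \<omega>"
      by (rule run_step_cong) simp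
    then show ?thesis
      by (simp add: Q_def)
  qed
  ultimately show ?thesis
    unfolding run_measure_def by (simp add: Q_def)
qed

text \<open>Countably many almost sure support statements hold jointly; \<open>is_mdp\<close> turns
  membership in the support of \<open>embed_pmf\<close> into a nonzero \<open>tprob\<close>.\<close>

lemma AE_run_transitions:
  fixes M :: "('s::finite, 'a::finite, 'z) mdp_scheme"
  assumes "is_mdp M"
  shows "AE \<omega> in run_measure M \<pi>. fst (\<omega> 0) = init_st M \<and>
    (\<forall>n. tprob M (fst (\<omega> n)) (snd (\<omega> n)) (fst (\<omega> (Suc n))) \<noteq> 0)"
proof -
  have "AE \<omega> in run_measure M \<pi>. \<forall>n. \<omega> n \<in> set_pmf (run_step M \<pi> n \<omega>)"
    by (simp add: AE_all_countable AE_run_step)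
  then show ?thesis
  proof (rule AE_mp, intro AE_I2 impI conjI allI)
    fix \<omega> :: "nat \<Rightarrow> 's \<times> 'a" and n
    assume *: "\<forall>n. \<omega> n \<in> set_pmf (run_step M \<pi> n \<omega>)"
    from *[rule_format, of 0] show "fst (\<omega> 0) = init_st M"
      by (auto simp: run_step_def)
    from *[rule_format, of "Suc n"]
    have "fst (\<omega> (Suc n)) \<in> set_pmf (embed_pmf (tprob M (fst (\<omega> n)) (snd (\<omega> n))))"
      by (auto simp: run_step_def)
    then show "tprob M (fst (\<omega> n)) (snd (\<omega> n)) (fst (\<omega> (Suc n))) \<noteq> 0"
      by (simp add: set_pmf_iff pmf_embed_tprob[OF assms])
  qed
qed

text \<open>\<open>M\<close> and \<open>N\<close> are kept separate because the shaped total reward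
  is also integrated against the run measure of the product MDP.\<close>

lemma borel_measurable_total_reward:
  fixes M :: "('s::finite, 'a::finite) rmdp" and N :: "('s, 'a, 'z) mdp_scheme"
  shows "total_reward M \<in> borel_measurable (run_measure N \<pi>)"
proof -
  let ?C = "count_space (UNIV :: ('s \<times> 'a) set)"
  have "(\<lambda>\<omega>. rew M (fst (\<omega> n)) (snd (\<omega> n)) (fst (\<omega> (Suc n))))
      \<in> borel_measurable (PiM UNIV (\<lambda>_. ?C))" for n
  proof -
    have "(\<lambda>\<omega>. (\<omega> n, \<omega> (Suc n))) \<in> PiM UNIV (\<lambda>_. ?C) \<rightarrow>\<^sub>M ?C \<Otimes>\<^sub>M ?C"
      by (intro measurable_Pair measurable_component_singleton) auto
    also have "?C \<Otimes>\<^sub>M ?C = count_space UNIV"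
      by (simp add: pair_measure_countable countable_finite)
    finally show ?thesis
      using measurable_compose[of _ _ "count_space UNIV" "\<lambda>(p, p'). rew M (fst p) (snd p) (fst p')" borel]
      by (simp add: case_prod_beta)
  qed
  then show ?thesis
    unfolding total_reward_def measurable_cong_sets[OF sets_run_measure refl]
    by (intro borel_measurable_suminf)
qed


section \<open>Distance to acceptance\<close>

lemma path_dist_finite_iff: "path_dist A q < \<infinity> \<longleftrightarrow> (q, final A) \<in> (edges A)\<^sup>*"
  unfolding path_dist_def INF_less_iff rtrancl_power by auto

lemma d_final_final: "d_final A (final A) = 0"
proof -
  have "path_dist A (final A) \<le> enat 0"
    unfolding path_dist_def by (rule INF_lower) simp
  then show ?thesis
    by (cases "path_dist A (final A)") (auto simp: d_final_def)
qed

lemma d_final_unreachable: "(q, final A) \<notin> (edges A)\<^sup>* \<Longrightarrow> d_final A q = d_max A"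
  by (simp add: d_final_def path_dist_finite_iff[symmetric])

lemma d_final_pos:
  assumes "q \<noteq> final A"
  shows "0 < d_final A q"
proof (cases "path_dist A q < \<infinity>")
  case True
  have "enat 1 \<le> path_dist A q"
    unfolding path_dist_def
  proof (rule INF_greatest)
    fix n assume "n \<in> {n. (q, final A) \<in> edges A ^^ n}"
    with assms show "enat 1 \<le> enat n"
      by (cases n) auto
  qed
  with True show ?thesis
    by (auto simp: d_final_def)
next
  case False
  then show ?thesis
    by (simp add: d_final_def d_max_def)
qed

lemma d_final_le_d_max:
  fixes A :: "('q::finite, 'l) dfa"
  shows "d_final A q \<le> d_max A"
proof (cases "path_dist A q < \<infinity>")
  case True
  then have "the_enat (path_dist A q) \<le> Max {the_enat (path_dist A q) | q. path_dist A q < \<infinity>}"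
    by (intro Max_ge) auto
  with True show ?thesis
    by (simp add: d_final_def d_max_def)
qed (simp add: d_final_def)

text \<open>The alternative that \<open>unrolled\<close> gives after the letters \<open>l 0\<close>
  to \<open>l T\<close> persists: the accepting state is absorbing, and a path to it from a
  successor would extend backwards by one edge.\<close>

lemma unrolled_absorbed:
  fixes A :: "('q, 'l) dfa" and q :: "nat \<Rightarrow> 'q" and l :: "nat \<Rightarrow> 'l"
  assumes "cosafety A" and "unrolled T A"
    and q0: "q 0 = start A" and qS: "\<And>n. q (Suc n) = delta A (q n) (l n)"
  shows "(\<forall>n\<ge>Suc T. q n = final A) \<or> (\<forall>n\<ge>Suc T. (q n, final A) \<notin> (edges A)\<^sup>*)"
proof -
  have "q n = foldl (delta A) (start A) (map l [0..<n])" for n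
    by (induction n) (simp_all add: q0 qS)
  then have "q (Suc T) = final A \<or> (q (Suc T), final A) \<notin> (edges A)\<^sup>*"
    using \<open>unrolled T A\<close> unfolding unrolled_def by (metis Suc_eq_plus1 diff_zero length_map length_upt)
  then show ?thesis
  proof
    assume F: "q (Suc T) = final A"
    have "q n = final A" if "n \<ge> Suc T" for n
      using that by (induction rule: dec_induct) (use F \<open>cosafety A\<close> in \<open>auto simp: qS cosafety_def\<close>)
    then show ?thesis by blast
  next
    assume D: "(q (Suc T), final A) \<notin> (edges A)\<^sup>*"
    have "(q n, final A) \<notin> (edges A)\<^sup>*" if "n \<ge> Suc T" for n
      using that
    proof (induction rule: dec_induct)
      case (step n)
      have "(q n, q (Suc n)) \<in> edges A"
        by (auto simp: edges_def qS)
      with step.IH show ?case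
        by (blast intro: converse_rtrancl_into_rtrancl)
    qed (rule D)
    then show ?thesis by blast
  qed
qed


section \<open>Comparison of the total rewards\<close>

lemma suminf_telescope_eventually_const:
  fixes f :: "nat \<Rightarrow> 'a::real_normed_vector"
  assumes "\<And>n. n \<ge> N \<Longrightarrow> f n = c"
  shows "(\<Sum>n. f (Suc n) - f n) = c - f 0"
proof -
  have "f \<longlonglongrightarrow> c"
    using assms by (intro tendsto_eventually) (auto simp: eventually_sequentially)
  then show ?thesis
    by (intro sums_unique[symmetric] telescope_sums)
qed

text \<open>This is \<open>P(d\<^sub>m\<^sub>a\<^sub>x) - P(d(q\<^sub>0))\<close>, since \<open>P(d(q\<^sub>0)) = 0\<close>.\<close>

definition reject_value :: "real \<Rightarrow> ('q::finite, 'l) dfa \<Rightarrow> real" where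
  "reject_value \<kappa> A = \<kappa> * ((real (d_max A) - real (d_final A (start A))) / (1 - real (d_max A)))"

text \<open>The numerator is nonnegative and the denominator negative. This sign makes the slope
  \<open>1 - reject_value \<kappa> A\<close> positive.\<close>

lemma reject_value_nonpos:
  assumes "0 < \<kappa>" and "d_max A > 1"
  shows "reject_value \<kappa> A \<le> 0"
  using assms d_final_le_d_max[of A "start A"]
  by (auto simp: reject_value_def divide_le_0_iff mult_le_0_iff)

text \<open>A pathwise statement: nonzero transition probabilities force the automaton component to
  be the deterministic run on the labels, so probability enters only afterwards.\<close>

lemma total_rewards_run:
  fixes S :: "('x, 'u) mdp" and A :: "('q::finite, 'l) dfa"
    and \<omega> :: "nat \<Rightarrow> ('x \<times> 'q) \<times> 'u"
  assumes "cosafety A" and "unrolled T A" and ne: "start A \<noteq> final A"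
    and init: "fst (\<omega> 0) = (init_st S, start A)"
    and step: "\<And>n. product_tprob S L A (fst (\<omega> n)) (snd (\<omega> n)) (fst (\<omega> (Suc n))) \<noteq> 0"
  shows "total_reward (product_mdp S L A) \<omega> \<in> {0, 1}"
    and "total_reward (shaped_mdp \<kappa> S L A) \<omega>
      = reject_value \<kappa> A + (1 - reject_value \<kappa> A) * total_reward (product_mdp S L A) \<omega>"
proof -
  define q where "q n = snd (fst (\<omega> n))" for n
  define l where "l n = L (fst (fst (\<omega> n)))" for n
  have q0: "q 0 = start A"
    by (simp add: q_def init)
  have qS: "q (Suc n) = delta A (q n) (l n)" for n
    using step[of n] by (auto simp: q_def l_def product_tprob_def case_prod_beta split: if_splits)
  define f where "f n = (if q n = final A then 1 else 0 :: real)" for n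
  define g where "g n = potential \<kappa> A (d_final A (q n))" for n
  \<comment> \<open>The self-loops at \<open>final A\<close> matter: leaving it would make the
    difference -1 while the reward is 0.\<close>
  have f_step: "rew (product_mdp S L A) (fst (\<omega> n)) (snd (\<omega> n)) (fst (\<omega> (Suc n))) = f (Suc n) - f n" for n
    using \<open>cosafety A\<close> qS[of n]
    by (auto simp: product_mdp_def star_reward_def f_def case_prod_beta cosafety_def q_def[symmetric])
  have g_step: "rew (shaped_mdp \<kappa> S L A) (fst (\<omega> n)) (snd (\<omega> n)) (fst (\<omega> (Suc n))) = g (Suc n) - g n" for n
    by (simp add: shaped_mdp_def shaped_reward_def g_def case_prod_beta q_def)
  \<comment> \<open>Since \<open>start A\<close> has positive distance, its potential is given by
    the \<open>\<kappa>\<close> branch, whose numerator vanishes there.\<close>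
  have f0: "f 0 = 0" and g0: "g 0 = 0"
    using ne d_final_pos[OF ne] by (simp_all add: f_def g_def q0 potential_def)
  have "total_reward (product_mdp S L A) \<omega> = 1 \<and> total_reward (shaped_mdp \<kappa> S L A) \<omega> = 1 \<or>
    total_reward (product_mdp S L A) \<omega> = 0 \<and> total_reward (shaped_mdp \<kappa> S L A) \<omega> = reject_value \<kappa> A"
    using unrolled_absorbed[OF assms(1,2) q0 qS]
  proof
    assume F: "\<forall>n\<ge>Suc T. q n = final A"
    have "f n = 1" "g n = 1" if "n \<ge> Suc T" for n
      using F that by (simp_all add: f_def g_def d_final_final potential_def)
    then have "(\<Sum>n. f (Suc n) - f n) = 1 - f 0" "(\<Sum>n. g (Suc n) - g n) = 1 - g 0"
      by (blast intro: suminf_telescope_eventually_const)+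
    then show ?thesis
      unfolding total_reward_def f_step g_step f0 g0 by simp
  next
    assume D: "\<forall>n\<ge>Suc T. (q n, final A) \<notin> (edges A)\<^sup>*"
    have "f n = 0" if "n \<ge> Suc T" for n
      using D that by (auto simp: f_def)
    \<comment> \<open>By its definition \<open>d_max A\<close> is at least 1, so states that cannot
      accept also fall under the \<open>\<kappa>\<close> branch.\<close>
    moreover have "g n = reject_value \<kappa> A" if "n \<ge> Suc T" for n
      using D that
      by (simp add: g_def d_final_unreachable potential_def reject_value_def d_max_def)
    ultimately have "(\<Sum>n. f (Suc n) - f n) = 0 - f 0"
      "(\<Sum>n. g (Suc n) - g n) = reject_value \<kappa> A - g 0"
      by (blast intro: suminf_telescope_eventually_const)+
    then show ?thesis
      unfolding total_reward_def f_step g_step f0 g0 by simp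
  qed
  then show "total_reward (product_mdp S L A) \<omega> \<in> {0, 1}"
    and "total_reward (shaped_mdp \<kappa> S L A) \<omega>
      = reject_value \<kappa> A + (1 - reject_value \<kappa> A) * total_reward (product_mdp S L A) \<omega>"
    by auto
qed

text \<open>The law of a run depends on transitions and initial state only, so both values are
  integrals against the same measure.\<close>

lemma run_measure_shaped_mdp:
  "run_measure (shaped_mdp \<kappa> S L A) \<pi> = run_measure (product_mdp S L A) \<pi>"
  by (simp add: run_measure_def run_step_def shaped_mdp_def cong: nat.case_cong)

lemma expected_total_reward_shaped:
  fixes S :: "('x::finite, 'u::finite) mdp" and A :: "('q::finite, 'l) dfa"
  assumes "is_mdp S" and "cosafety A" and "unrolled T A" and "start A \<noteq> final A"
  shows "expected_total_reward (shaped_mdp \<kappa> S L A) \<pi>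
    = reject_value \<kappa> A + (1 - reject_value \<kappa> A) * expected_total_reward (product_mdp S L A) \<pi>"
proof -
  let ?M = "product_mdp S L A" and ?M' = "shaped_mdp \<kappa> S L A" and ?c = "reject_value \<kappa> A"
  interpret prob_space "run_measure ?M \<pi>"
    by (rule prob_space_run_measure)
  note meas = borel_measurable_total_reward
  have AE_run: "AE \<omega> in run_measure ?M \<pi>. total_reward ?M \<omega> \<in> {0, 1} \<and>
      total_reward ?M' \<omega> = ?c + (1 - ?c) * total_reward ?M \<omega>"
    using AE_run_transitions[OF is_mdp_product_mdp[OF \<open>is_mdp S\<close>], of L A \<pi>]
  proof (rule AE_mp, intro AE_I2 impI)
    fix \<omega>
    assume "fst (\<omega> 0) = init_st ?M \<and> (\<forall>n. tprob ?M (fst (\<omega> n)) (snd (\<omega> n)) (fst (\<omega> (Suc n))) \<noteq> 0)"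
    then have "fst (\<omega> 0) = (init_st S, start A)"
      and "product_tprob S L A (fst (\<omega> n)) (snd (\<omega> n)) (fst (\<omega> (Suc n))) \<noteq> 0" for n
      by (simp_all add: product_mdp_def)
    from total_rewards_run[OF assms(2-4) this]
    show "total_reward ?M \<omega> \<in> {0, 1} \<and> total_reward ?M' \<omega> = ?c + (1 - ?c) * total_reward ?M \<omega>"
      by blast
  qed
  \<comment> \<open>Linearity of the integral needs integrability, which follows from the values
    lying in \<open>{0, 1}\<close> almost surely.\<close>
  have "integrable (run_measure ?M \<pi>) (total_reward ?M)"
    using AE_run by (intro integrable_const_bound[where B=1] meas) auto
  then have "(\<integral>\<omega>. ?c + (1 - ?c) * total_reward ?M \<omega> \<partial>run_measure ?M \<pi>)
      = ?c + (1 - ?c) * (\<integral>\<omega>. total_reward ?M \<omega> \<partial>run_measure ?M \<pi>)"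
    by (simp add: prob_space)
  moreover have "(\<integral>\<omega>. total_reward ?M' \<omega> \<partial>run_measure ?M \<pi>)
      = (\<integral>\<omega>. ?c + (1 - ?c) * total_reward ?M \<omega> \<partial>run_measure ?M \<pi>)"
    using AE_run
    by (intro integral_cong_AE meas borel_measurable_add borel_measurable_times borel_measurable_const) auto
  ultimately show ?thesis
    by (simp add: expected_total_reward_def run_measure_shaped_mdp)
qed

theorem theorem4p4:
  fixes S :: "('x::finite, 'u::finite) mdp"
    and L :: "'x \<Rightarrow> 'l::finite"
    and A :: "('q::finite, 'l) dfa"
    and T :: nat
  assumes "is_mdp S"
    and "cosafety A"
    and "unrolled T A"
    and "start A \<noteq> final A"
    and "d_max A > 1"
  shows "\<exists>\<kappa>\<^sub>s>0. \<forall>\<kappa>::real. 0 < \<kappa> \<and> \<kappa> < \<kappa>\<^sub>s \<longrightarrow>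
    {\<pi>. optimal_policy (product_mdp S L A) \<pi>} = {\<pi>. optimal_policy (shaped_mdp \<kappa> S L A) \<pi>}"
\<comment> \<open>The witness 1 is an arbitrary positive bound.\<close>
proof (intro exI[of _ 1] conjI allI impI)
  fix \<kappa> :: real assume "0 < \<kappa> \<and> \<kappa> < 1"
  then have "reject_value \<kappa> A \<le> 0"
    using reject_value_nonpos \<open>d_max A > 1\<close> by blast
  \<comment> \<open>In each comparison of two shaped values the common offset cancels, and so does
    the positive factor \<open>1 - reject_value \<kappa> A\<close>.\<close>
  then show "{\<pi>. optimal_policy (product_mdp S L A) \<pi>} = {\<pi>. optimal_policy (shaped_mdp \<kappa> S L A) \<pi>}"
    by (simp add: optimal_policy_def expected_total_reward_shaped[OF assms(1-4)])
qed simp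

end
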